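(* Let $\mathbf v_1,\dots,\mathbf v_m\in\mathbb R^n$ be nonzero vectors with $\sum_{k=1}^m \mathbf v_k\mathbf v_k^\top=I_n$, let $j_i$, $R_i$ ($i\ge1$) be the iterates of the nonnegative UGA algorithm described in the context, and let $$K=\min_{S\in\mathcal F}\ \sum_{k\in S}s_k,$$ where $\mathcal F$ is the set of all index sets $S\subset\{1,\dots,m\}$ for which there exist $s_k>0$ ($k\in S$) with $\sum_{k\in S}s_k\mathbf v_k\mathbf v_k^\top=I_n$ (the minimum being over all such $S$ and such coefficients). Then for all $i\ge1$, $$\|R_{i+1}\|_F^2\le \frac{K^2}{K^2/n+\sum_{k=1}^i 1/\|\mathbf v_{j_k}\|_2^4}.$$
   Context: The nonnegative UGA algorithm: initialize $R_0=I_n$, $L_0=0$. For $i=1,2,\dots$: choose an index $j_i$ with $\mathbf v_{j_i}^\top R_{i-1}\mathbf v_{j_i}=\max_{1\le j\le m}\mathbf v_j^\top R_{i-1}\mathbf v_j$; compute $(\alpha_1^i,\alpha_2^i)\in\arg\min_{(\alpha_1,\alpha_2)\in\mathbb R^2}\|I_n-\alpha_1L_{i-1}-\alpha_2\mathbf v_{j_i}\mathbf v_{j_i}^\top\|_F^2$; set $L_i=\alpha_1^iL_{i-1}+\alpha_2^i\mathbf v_{j_i}\mathbf v_{j_i}^\top$ and $R_i=I_n-L_i$. $\|\cdot\|_F$ denotes the Frobenius norm. *)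

theory Defs
  imports "HOL-Analysis.Analysis"
begin

text \<open>A matrix is a vector of rows, so the library norm on \<^typ>\<open>real ^ 'n ^ 'm\<close> is the Frobenius norm.\<close>

lemma norm_matrix_eq_frobenius:
  fixes A :: "real ^ 'n ^ 'm"
  shows "norm A = sqrt (\<Sum>i\<in>UNIV. \<Sum>j\<in>UNIV. (A $ i $ j)\<^sup>2)"
  by (simp add: norm_vec_def L2_set_def sum_nonneg)

text \<open>The inner dimension must be pinned to \<open>1\<close>: \<^const>\<open>columnvector\<close> and \<^const>\<open>rowvector\<close> are polymorphic in it.\<close>

definition outer :: "real ^ 'n \<Rightarrow> real ^ 'n ^ 'n" where
  "outer v = (columnvector v :: real ^ 1 ^ 'n) ** (rowvector v :: real ^ 'n ^ 1)"

lemma outer_nth: "outer v $ i $ j = v $ i * v $ j"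
  by (simp add: outer_def matrix_matrix_mult_def columnvector_def rowvector_def)

text \<open>
  The sequences describe an execution of the algorithm: \<open>j i\<close> is the index selected in
  round \<open>i \<ge> 1\<close>, and \<open>a i\<close>, \<open>b i\<close> are the two coefficients. The values of \<open>j\<close>, \<open>a\<close>, \<open>b\<close> at \<open>0\<close>
  are irrelevant. Neither the maximising index nor the minimising pair need be unique, hence
  a predicate rather than a function.
\<close>

definition nonneg_uga_run ::
  "('m::finite \<Rightarrow> real ^ 'n) \<Rightarrow> (nat \<Rightarrow> 'm) \<Rightarrow> (nat \<Rightarrow> real) \<Rightarrow> (nat \<Rightarrow> real)
    \<Rightarrow> (nat \<Rightarrow> real ^ 'n ^ 'n) \<Rightarrow> (nat \<Rightarrow> real ^ 'n ^ 'n) \<Rightarrow> bool"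
where
  "nonneg_uga_run v j a b L R \<longleftrightarrow>
     R 0 = mat 1 \<and> L 0 = 0 \<and>
     (\<forall>i\<ge>1.
        v (j i) \<bullet> (R (i - 1) *v v (j i)) = Max (range (\<lambda>k. v k \<bullet> (R (i - 1) *v v k))) \<and>
        is_arg_min
          (\<lambda>(\<alpha>, \<beta>). (norm (mat 1 - \<alpha> *\<^sub>R L (i - 1) - \<beta> *\<^sub>R outer (v (j i))))\<^sup>2)
          (\<lambda>_. True) (a i, b i) \<and>
        L i = a i *\<^sub>R L (i - 1) + b i *\<^sub>R outer (v (j i)) \<and>
        R i = mat 1 - L i)"

definition identity_decomposition ::
  "('m \<Rightarrow> real ^ 'n) \<Rightarrow> 'm set \<Rightarrow> ('m \<Rightarrow> real) \<Rightarrow> bool"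
where
  "identity_decomposition v S s \<longleftrightarrow>
     (\<forall>k\<in>S. 0 < s k) \<and> (\<Sum>k\<in>S. s k *\<^sub>R outer (v k)) = mat 1"

definition decomposition_weights :: "('m \<Rightarrow> real ^ 'n) \<Rightarrow> real set" where
  "decomposition_weights v = {\<Sum>k\<in>S. s k | S s. identity_decomposition v S s}"

text \<open>The minimum of an infinite set of reals, written as an infimum; attainment is not part of
  this definition and has to be established separately.\<close>

definition min_decomposition_weight :: "('m \<Rightarrow> real ^ 'n) \<Rightarrow> real" where
  "min_decomposition_weight v = Inf (decomposition_weights v)"

end

theory Submission
  imports Defs
begin

text \<open>
  Write \<open>g\<^sub>k\<close> for the matrix \<open>v\<^sub>k v\<^sub>k\<^sup>T\<close> and \<open>r\<^sub>i\<close> for the squared Frobenius norm of \<open>R\<^sub>i\<close>.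
  As \<open>L\<^sub>i\<close> is the orthogonal projection of the identity onto a subspace, \<open>R\<^sub>i\<close> is orthogonal
  to \<open>L\<^sub>i\<close>, so that \<open>r\<^sub>i\<close> is the inner product of \<open>R\<^sub>i\<close> with the identity. Expanding the
  identity in a decomposition of minimal weight \<open>K\<close> bounds this by \<open>K\<close> times the largest inner
  product of \<open>R\<^sub>i\<close> with some \<open>g\<^sub>k\<close>. The next step does at least as well as subtracting the
  projection of \<open>R\<^sub>i\<close> onto the chosen \<open>g\<^sub>k\<close>, whence
  \<open>r\<^bsub>i+1\<^esub> \<le> r\<^sub>i - r\<^sub>i\<^sup>2 / (K\<^sup>2 |v\<^sub>k|\<^sup>4)\<close>; taking reciprocals turns this into an additive recursion.
\<close>

section \<open>Rank-one matrices and projections\<close>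

text \<open>Translates the quadratic forms of the selection rule into Frobenius inner
  products.\<close>

lemma outer_inner: "outer x \<bullet> A = x \<bullet> (A *v x)"
  by (simp add: inner_vec_def outer_nth matrix_vector_mult_def sum_distrib_left mult_ac)

lemma norm_outer: "norm (outer x) = (norm x)\<^sup>2"
proof -
  have "outer x *v x = (x \<bullet> x) *\<^sub>R x"
    by (simp add: vec_eq_iff matrix_vector_mult_def outer_nth inner_vec_def
        sum_distrib_left mult_ac)
  then have "(norm (outer x))\<^sup>2 = ((norm x)\<^sup>2)\<^sup>2"
    unfolding power2_norm_eq_inner by (simp add: outer_inner power2_eq_square)
  then show ?thesis
    by (simp only: power2_eq_iff_nonneg norm_ge_zero zero_le_power2)
qed

lemma mat_1_inner_self: "(mat 1 :: real ^ 'n ^ 'n) \<bullet> mat 1 = real CARD('n)"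
  by (simp add: inner_vec_def mat_def if_distrib[of "\<lambda>x. x * _"] cong: if_cong)

lemma inner_mat_1_outer: "mat 1 \<bullet> outer x = (norm x)\<^sup>2"
  by (simp add: inner_commute[of "mat 1"] outer_inner power2_norm_eq_inner)

text \<open>Pythagoras for the projection onto the line through \<open>y\<close>; for
  \<open>y = 0\<close> both quotients are 0.\<close>

lemma norm_diff_projection:
  fixes w y :: "'a::real_inner"
  shows "(norm (w - ((w \<bullet> y) / (y \<bullet> y)) *\<^sub>R y))\<^sup>2 = (norm w)\<^sup>2 - (w \<bullet> y)\<^sup>2 / (norm y)\<^sup>2"
  unfolding power2_norm_eq_inner
  by (cases "y = 0") (simp_all add: inner_diff inner_commute power2_eq_square)

text \<open>Otherwise subtracting the projection of \<open>w\<close> onto \<open>y\<close> would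
  strictly shorten \<open>w\<close>.\<close>

lemma best_approximation_orthogonal:
  fixes w y :: "'a::real_inner"
  assumes "\<And>t. (norm w)\<^sup>2 \<le> (norm (w - t *\<^sub>R y))\<^sup>2"
  shows "w \<bullet> y = 0"
proof (rule ccontr)
  assume *: "w \<bullet> y \<noteq> 0"
  then have "(w \<bullet> y)\<^sup>2 / (norm y)\<^sup>2 > 0"
    by (intro divide_pos_pos) auto
  then show False
    using assms[of "(w \<bullet> y) / (y \<bullet> y)"] unfolding norm_diff_projection by simp
qed

section \<open>Decompositions of the identity and the minimal weight\<close>

text \<open>Allowing zero coefficients replaces the varying index set and strict positivity by a
  closed condition in one Euclidean space, so that compactness applies.\<close>

definition nonneg_decompositions :: "('m::finite \<Rightarrow> real ^ 'n) \<Rightarrow> (real ^ 'm) set" where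
  "nonneg_decompositions v =
     {s. (\<forall>k. 0 \<le> s $ k) \<and> (\<Sum>k\<in>UNIV. s $ k *\<^sub>R outer (v k)) = mat 1}"

text \<open>Extend coefficients by zero in one direction, restrict to the support in the
  other.\<close>

lemma decomposition_weights_eq_image:
  fixes v :: "'m::finite \<Rightarrow> real ^ 'n"
  shows "decomposition_weights v = (\<lambda>s. \<Sum>k\<in>UNIV. s $ k) ` nonneg_decompositions v"
proof (intro equalityI subsetI)
  fix x assume "x \<in> decomposition_weights v"
  then obtain S s where x: "x = (\<Sum>k\<in>S. s k)" and pos: "\<And>k. k \<in> S \<Longrightarrow> 0 < s k"
    and I: "(\<Sum>k\<in>S. s k *\<^sub>R outer (v k)) = mat 1"
    by (auto simp: decomposition_weights_def identity_decomposition_def)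
  define t :: "real ^ 'm" where "t = (\<chi> k. if k \<in> S then s k else 0)"
  have "(\<Sum>k\<in>UNIV. t $ k *\<^sub>R outer (v k)) = (\<Sum>k\<in>S. s k *\<^sub>R outer (v k))"
    by (rule sum.mono_neutral_cong_right) (auto simp: t_def)
  moreover have "(\<Sum>k\<in>UNIV. t $ k) = x"
    unfolding x by (rule sum.mono_neutral_cong_right) (auto simp: t_def)
  moreover have "0 \<le> t $ k" for k
    using pos[of k] by (simp add: t_def less_imp_le)
  ultimately show "x \<in> (\<lambda>s. \<Sum>k\<in>UNIV. s $ k) ` nonneg_decompositions v"
    using I by (auto simp: nonneg_decompositions_def intro!: rev_image_eqI[of t])
next
  fix x assume "x \<in> (\<lambda>s. \<Sum>k\<in>UNIV. s $ k) ` nonneg_decompositions v"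
  then obtain t where x: "x = (\<Sum>k\<in>UNIV. t $ k)" and nn: "\<And>k. 0 \<le> t $ k"
    and I: "(\<Sum>k\<in>UNIV. t $ k *\<^sub>R outer (v k)) = mat 1"
    by (auto simp: nonneg_decompositions_def)
  define S where "S = {k. t $ k \<noteq> 0}"
  have "(\<Sum>k\<in>S. t $ k *\<^sub>R outer (v k)) = (\<Sum>k\<in>UNIV. t $ k *\<^sub>R outer (v k))"
    by (rule sum.mono_neutral_left) (auto simp: S_def)
  moreover have "(\<Sum>k\<in>S. t $ k) = (\<Sum>k\<in>UNIV. t $ k)"
    by (rule sum.mono_neutral_left) (auto simp: S_def)
  moreover have "0 < t $ k" if "k \<in> S" for k
    using nn[of k] that by (simp add: S_def)
  ultimately have "identity_decomposition v S (($) t)" "x = (\<Sum>k\<in>S. t $ k)"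
    using I x by (auto simp: identity_decomposition_def)
  then show "x \<in> decomposition_weights v"
    unfolding decomposition_weights_def by blast
qed

text \<open>Taking traces in a decomposition bounds its coefficients.\<close>

lemma nonneg_decompositions_trace:
  fixes v :: "'m::finite \<Rightarrow> real ^ 'n"
  assumes "s \<in> nonneg_decompositions v"
  shows "(\<Sum>k\<in>UNIV. s $ k * (norm (v k))\<^sup>2) = real CARD('n)"
proof -
  have "real CARD('n) = mat 1 \<bullet> (\<Sum>k\<in>UNIV. s $ k *\<^sub>R outer (v k))"
    using assms by (simp add: nonneg_decompositions_def mat_1_inner_self)
  then show ?thesis
    by (simp add: inner_sum_right inner_mat_1_outer)
qed

lemma compact_nonneg_decompositions:
  fixes v :: "'m::finite \<Rightarrow> real ^ 'n"
  assumes nonzero: "\<And>k. v k \<noteq> 0"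
  shows "compact (nonneg_decompositions v)"
proof -
  \<comment> \<open>The summands of the trace identity are nonnegative, so each is at most the
    dimension.\<close>
  define u :: "real ^ 'm" where "u = (\<chi> k. real CARD('n) / (norm (v k))\<^sup>2)"
  have "nonneg_decompositions v \<subseteq> cbox 0 u"
  proof
    fix s assume s: "s \<in> nonneg_decompositions v"
    then have nn: "0 \<le> s $ k" for k
      by (simp add: nonneg_decompositions_def)
    have "s $ k * (norm (v k))\<^sup>2 \<le> (\<Sum>k\<in>UNIV. s $ k * (norm (v k))\<^sup>2)" for k
      by (rule member_le_sum) (auto simp: nn)
    then have "s $ k \<le> u $ k" for k
      using nonzero[of k] by (simp add: nonneg_decompositions_trace[OF s] u_def pos_le_divide_eq)
    with nn show "s \<in> cbox 0 u"
      by (simp add: mem_box_cart)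
  qed
  then have "bounded (nonneg_decompositions v)"
    using bounded_cbox bounded_subset by blast
  moreover have "closed (nonneg_decompositions v)"
    unfolding nonneg_decompositions_def
    by (intro closed_Collect_conj closed_Collect_all closed_Collect_le closed_Collect_eq
        continuous_intros)
  ultimately show ?thesis
    by (simp add: compact_eq_bounded_closed)
qed

text \<open>The weights are a continuous image of a compact set, nonempty because all coefficients
  may be 1; hence the infimum is a minimum.\<close>

lemma min_decomposition_weight_attained:
  fixes v :: "'m::finite \<Rightarrow> real ^ 'n"
  assumes nonzero: "\<And>k. v k \<noteq> 0"
    and identity: "(\<Sum>k\<in>UNIV. outer (v k)) = mat 1"
  shows "min_decomposition_weight v \<in> decomposition_weights v"
    and "\<And>x. x \<in> decomposition_weights v \<Longrightarrow> min_decomposition_weight v \<le> x"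
proof -
  have "(\<chi> k. 1) \<in> nonneg_decompositions v"
    by (simp add: nonneg_decompositions_def identity)
  then have ne: "decomposition_weights v \<noteq> {}"
    unfolding decomposition_weights_eq_image by blast
  have "compact (decomposition_weights v)"
    unfolding decomposition_weights_eq_image
    by (intro compact_continuous_image compact_nonneg_decompositions nonzero continuous_intros)
  then have *: "closed (decomposition_weights v)" "bdd_below (decomposition_weights v)"
    by (auto simp: compact_imp_closed bounded_imp_bdd_below compact_imp_bounded)
  show "min_decomposition_weight v \<in> decomposition_weights v"
    unfolding min_decomposition_weight_def by (rule closed_contains_Inf[OF ne *(2,1)])
  show "min_decomposition_weight v \<le> x" if "x \<in> decomposition_weights v" for x
    unfolding min_decomposition_weight_def by (rule cInf_lower[OF that *(2)])
qed

text \<open>Zero weight would make all coefficients vanish, contradicting the positive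
  trace.\<close>

lemma decomposition_weight_pos:
  fixes v :: "'m::finite \<Rightarrow> real ^ 'n"
  assumes "x \<in> decomposition_weights v"
  shows "0 < x"
proof -
  obtain s where s: "s \<in> nonneg_decompositions v" and x: "x = (\<Sum>k\<in>UNIV. s $ k)"
    using assms by (auto simp: decomposition_weights_eq_image)
  have nn: "0 \<le> s $ k" for k
    using s by (simp add: nonneg_decompositions_def)
  have "x \<noteq> 0"
  proof
    assume "x = 0"
    then have "s $ k = 0" for k
      using nn by (simp add: x sum_nonneg_eq_0_iff)
    then show False
      using nonneg_decompositions_trace[OF s] by simp
  qed
  with nn show ?thesis
    by (simp add: x sum_nonneg less_le)
qed

lemma inner_mat_1_le_decomposition_weight:
  fixes v :: "'m::finite \<Rightarrow> real ^ 'n"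
  assumes "x \<in> decomposition_weights v" and max: "\<And>k. v k \<bullet> (A *v v k) \<le> M"
  shows "mat 1 \<bullet> A \<le> x * M"
proof -
  obtain s where s: "s \<in> nonneg_decompositions v" and x: "x = (\<Sum>k\<in>UNIV. s $ k)"
    using assms(1) by (auto simp: decomposition_weights_eq_image)
  have nn: "0 \<le> s $ k" for k
    using s by (simp add: nonneg_decompositions_def)
  have "mat 1 \<bullet> A = (\<Sum>k\<in>UNIV. s $ k *\<^sub>R outer (v k)) \<bullet> A"
    using s by (simp add: nonneg_decompositions_def)
  also have "\<dots> = (\<Sum>k\<in>UNIV. s $ k * (v k \<bullet> (A *v v k)))"
    by (simp add: inner_sum_left outer_inner)
  also have "\<dots> \<le> (\<Sum>k\<in>UNIV. s $ k * M)"
    by (intro sum_mono mult_left_mono max nn)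
  finally show ?thesis
    by (simp add: x sum_distrib_right)
qed

section \<open>Residuals of a run\<close>

lemma nonneg_uga_run_best_approximation:
  assumes "nonneg_uga_run v j a b L R"
  shows "(norm (R (Suc i)))\<^sup>2 \<le> (norm (mat 1 - \<alpha> *\<^sub>R L i - \<beta> *\<^sub>R outer (v (j (Suc i)))))\<^sup>2"
proof -
  have "is_arg_min
      (\<lambda>(\<alpha>, \<beta>). (norm (mat 1 - \<alpha> *\<^sub>R L i - \<beta> *\<^sub>R outer (v (j (Suc i)))))\<^sup>2)
      (\<lambda>_. True) (a (Suc i), b (Suc i))"
    and "R (Suc i) = mat 1 - a (Suc i) *\<^sub>R L i - b (Suc i) *\<^sub>R outer (v (j (Suc i)))"
    using assms by (auto simp: nonneg_uga_run_def dest!: spec[of _ "Suc i"])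
  then show ?thesis
    by (auto simp: is_arg_min_linorder)
qed

lemma nonneg_uga_run_residual:
  assumes "nonneg_uga_run v j a b L R"
  shows "R i = mat 1 - L i"
proof (cases i)
  case (Suc i')
  then show ?thesis
    using assms by (simp add: nonneg_uga_run_def)
qed (use assms in \<open>simp add: nonneg_uga_run_def\<close>)

lemma nonneg_uga_run_orthogonal:
  assumes run: "nonneg_uga_run v j a b L R"
  shows "R i \<bullet> L i = 0"
proof (cases i)
  case 0
  then show ?thesis
    using run by (simp add: nonneg_uga_run_def)
next
  case (Suc i')
  let ?g = "outer (v (j i))"
  have L: "L i = a i *\<^sub>R L i' + b i *\<^sub>R ?g"
    using run Suc by (simp add: nonneg_uga_run_def)
  have "R i \<bullet> L i' = 0"
  proof (rule best_approximation_orthogonal)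
    fix t
    \<comment> \<open>A shift along \<open>L i'\<close> only changes the first coefficient, so the
      result is again a competitor in the minimisation of round \<open>i\<close>.\<close>
    have "R i - t *\<^sub>R L i' = mat 1 - (a i + t) *\<^sub>R L i' - b i *\<^sub>R ?g"
      by (simp add: nonneg_uga_run_residual[OF run] L algebra_simps)
    then show "(norm (R i))\<^sup>2 \<le> (norm (R i - t *\<^sub>R L i'))\<^sup>2"
      using nonneg_uga_run_best_approximation[OF run, of i'] Suc by simp
  qed
  moreover have "R i \<bullet> ?g = 0"
  proof (rule best_approximation_orthogonal)
    fix t
    have "R i - t *\<^sub>R ?g = mat 1 - a i *\<^sub>R L i' - (b i + t) *\<^sub>R ?g"
      by (simp add: nonneg_uga_run_residual[OF run] L algebra_simps)
    then show "(norm (R i))\<^sup>2 \<le> (norm (R i - t *\<^sub>R ?g))\<^sup>2"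
      using nonneg_uga_run_best_approximation[OF run, of i'] Suc by simp
  qed
  ultimately show ?thesis
    by (simp add: L inner_add_right)
qed

lemma nonneg_uga_run_norm_le:
  fixes v :: "'m::finite \<Rightarrow> real ^ 'n"
  assumes run: "nonneg_uga_run v j a b L R" and x: "x \<in> decomposition_weights v"
  shows "(norm (R i))\<^sup>2 \<le> x * (outer (v (j (Suc i))) \<bullet> R i)"
proof -
  have "v (j (Suc i)) \<bullet> (R i *v v (j (Suc i))) = Max (range (\<lambda>k. v k \<bullet> (R i *v v k)))"
    using run by (auto simp: nonneg_uga_run_def dest!: spec[of _ "Suc i"])
  then have "v k \<bullet> (R i *v v k) \<le> outer (v (j (Suc i))) \<bullet> R i" for k
    by (simp add: outer_inner)
  then have "mat 1 \<bullet> R i \<le> x * (outer (v (j (Suc i))) \<bullet> R i)"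
    by (rule inner_mat_1_le_decomposition_weight[OF x])
  \<comment> \<open>Pair \<open>mat 1 = R i + L i\<close> with \<open>R i\<close>; the second term
    vanishes by orthogonality.\<close>
  moreover have "(norm (R i))\<^sup>2 = mat 1 \<bullet> R i"
    using nonneg_uga_run_orthogonal[OF run, of i] nonneg_uga_run_residual[OF run, of i]
    by (simp add: power2_norm_eq_inner inner_diff inner_commute)
  ultimately show ?thesis
    by simp
qed

lemma nonneg_uga_run_step:
  fixes v :: "'m::finite \<Rightarrow> real ^ 'n"
  assumes run: "nonneg_uga_run v j a b L R" and x: "x \<in> decomposition_weights v"
  shows "(norm (R (Suc i)))\<^sup>2 \<le>
    (norm (R i))\<^sup>2 - ((norm (R i))\<^sup>2)\<^sup>2 * (1 / norm (v (j (Suc i))) ^ 4 / x\<^sup>2)"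
proof -
  let ?g = "outer (v (j (Suc i)))"
  have pos: "0 < x"
    by (rule decomposition_weight_pos[OF x])
  \<comment> \<open>The competitor keeps \<open>L i\<close> (coefficient 1) and adds the projection
    of \<open>R i\<close> onto \<open>?g\<close>.\<close>
  have "(norm (R (Suc i)))\<^sup>2 \<le> (norm (R i - ((R i \<bullet> ?g) / (?g \<bullet> ?g)) *\<^sub>R ?g))\<^sup>2"
    using nonneg_uga_run_best_approximation[OF run, of i 1]
    by (simp add: nonneg_uga_run_residual[OF run, of i])
  also have "\<dots> = (norm (R i))\<^sup>2 - (?g \<bullet> R i)\<^sup>2 * (1 / norm (v (j (Suc i))) ^ 4)"
    by (simp add: norm_diff_projection norm_outer inner_commute flip: power_mult)
  finally have le: "(norm (R (Suc i)))\<^sup>2 \<le>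
    (norm (R i))\<^sup>2 - (?g \<bullet> R i)\<^sup>2 * (1 / norm (v (j (Suc i))) ^ 4)" .
  have "(norm (R i))\<^sup>2 / x \<le> ?g \<bullet> R i"
    using nonneg_uga_run_norm_le[OF run x, of i] pos by (simp add: divide_le_eq mult.commute)
  then have "((norm (R i))\<^sup>2 / x)\<^sup>2 \<le> (?g \<bullet> R i)\<^sup>2"
    using pos by (intro power_mono) auto
  then have "((norm (R i))\<^sup>2 / x)\<^sup>2 * (1 / norm (v (j (Suc i))) ^ 4)
    \<le> (?g \<bullet> R i)\<^sup>2 * (1 / norm (v (j (Suc i))) ^ 4)"
    by (intro mult_right_mono) auto
  with le show ?thesis
    by (simp add: power_divide mult_ac)
qed

section \<open>Solving the recursion\<close>

text \<open>The bounds are kept in product form because the residual may vanish.\<close>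

lemma quadratic_recursion_step:
  fixes r r' c D :: real
  assumes "0 \<le> r" "0 \<le> c" "0 < D" "r' \<le> r - r\<^sup>2 * c" "r * D \<le> 1"
  shows "r' * (D + c) \<le> 1"
proof -
  have "r' * (D + c) \<le> (r - r\<^sup>2 * c) * (D + c)"
    using assms by (intro mult_right_mono) auto
  also have "\<dots> = (1 - r * c) * (r * D) + r * c * (1 - r * c)"
    by (simp add: algebra_simps power2_eq_square)
  also have "\<dots> \<le> 1"
  \<comment> \<open>The sign of \<open>1 - r * c\<close> decides whether
    \<open>r * D \<le> 1\<close> may be inserted; if it is negative, both summands are
    nonpositive.\<close>
  proof (cases "r * c \<le> 1")
    case True
    then have "(1 - r * c) * (r * D) \<le> (1 - r * c) * 1"
      using assms by (intro mult_left_mono) auto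
    moreover have "(1 - r * c) * 1 + r * c * (1 - r * c) = 1 - (r * c)\<^sup>2"
      by (simp add: algebra_simps power2_eq_square)
    ultimately show ?thesis
      using zero_le_power2[of "r * c"] by linarith
  next
    case False
    then have "(1 - r * c) * (r * D) \<le> 0"
      using assms by (intro mult_nonpos_nonneg mult_nonneg_nonneg) auto
    moreover have "r * c * (1 - r * c) \<le> 0"
      using False assms by (intro mult_nonneg_nonpos mult_nonneg_nonneg) auto
    ultimately show ?thesis
      by linarith
  qed
  finally show ?thesis .
qed

lemma nonneg_uga_run_convergence:
  fixes v :: "'m::finite \<Rightarrow> real ^ 'n"
  assumes run: "nonneg_uga_run v j a b L R" and x: "x \<in> decomposition_weights v"
  shows "(norm (R i))\<^sup>2 \<le> x\<^sup>2 / (x\<^sup>2 / real CARD('n) + (\<Sum>k=1..i. 1 / norm (v (j k)) ^ 4))"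
proof -
  \<comment> \<open>\<open>D i\<close> is the reciprocal of the claimed bound; each round adds the
    constant of the one-step estimate. Initially the squared norm of \<open>mat 1\<close> is the
    dimension, so equality holds.\<close>
  define D where "D i = 1 / real CARD('n) + (\<Sum>k=1..i. 1 / norm (v (j k)) ^ 4 / x\<^sup>2)" for i
  have pos: "0 < x"
    by (rule decomposition_weight_pos[OF x])
  have Dpos: "0 < D i" for i
    unfolding D_def by (intro add_pos_nonneg sum_nonneg) auto
  have "(norm (R i))\<^sup>2 * D i \<le> 1"
  proof (induction i)
    case 0
    have "R 0 = mat 1"
      using run by (simp add: nonneg_uga_run_def)
    then show ?case
      by (simp add: D_def power2_norm_eq_inner mat_1_inner_self)
  next
    case (Suc i)
    have "(norm (R (Suc i)))\<^sup>2 * (D i + 1 / norm (v (j (Suc i))) ^ 4 / x\<^sup>2) \<le> 1"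
      by (rule quadratic_recursion_step[OF _ _ Dpos nonneg_uga_run_step[OF run x] Suc.IH]) auto
    then show ?case
      by (simp add: D_def add.assoc)
  qed
  then have "(norm (R i))\<^sup>2 \<le> 1 / D i"
    using Dpos by (simp add: pos_le_divide_eq)
  also have "1 / D i = x\<^sup>2 / (x\<^sup>2 * D i)"
    using pos by simp
  also have "x\<^sup>2 * D i = x\<^sup>2 / real CARD('n) + (\<Sum>k=1..i. 1 / norm (v (j k)) ^ 4)"
    using pos by (simp add: D_def distrib_left sum_distrib_left)
  finally show ?thesis .
qed

text \<open>The coefficients 1 and 0 leave \<open>L i\<close> unchanged and are a competitor in the
  next round.\<close>

lemma nonneg_uga_run_antimono:
  assumes run: "nonneg_uga_run v j a b L R"
  shows "(norm (R (Suc i)))\<^sup>2 \<le> (norm (R i))\<^sup>2"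
  using nonneg_uga_run_best_approximation[OF run, of i 1 0]
  by (simp add: nonneg_uga_run_residual[OF run, of i])

theorem theorem2p8:
  fixes v :: "'m::finite \<Rightarrow> real ^ 'n"
    and j :: "nat \<Rightarrow> 'm"
    and a b :: "nat \<Rightarrow> real"
    and L R :: "nat \<Rightarrow> real ^ 'n ^ 'n"
    and K :: real
  assumes nonzero: "\<And>k. v k \<noteq> 0"
    and identity: "(\<Sum>k\<in>UNIV. outer (v k)) = mat 1"
    and run: "nonneg_uga_run v j a b L R"
    and K: "K = min_decomposition_weight v"
  shows "K \<in> decomposition_weights v \<and> (\<forall>x\<in>decomposition_weights v. K \<le> x) \<and>
    (\<forall>i\<ge>1. (norm (R (i + 1)))\<^sup>2 \<le>
       K\<^sup>2 / (K\<^sup>2 / real CARD('n) + (\<Sum>k=1..i. 1 / norm (v (j k)) ^ 4)))"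
proof (intro conjI allI impI ballI)
  show K_mem: "K \<in> decomposition_weights v"
    unfolding K by (rule min_decomposition_weight_attained(1)[OF nonzero identity])
  show "K \<le> x" if "x \<in> decomposition_weights v" for x
    unfolding K by (rule min_decomposition_weight_attained(2)[OF nonzero identity that])
  show "(norm (R (i + 1)))\<^sup>2 \<le>
      K\<^sup>2 / (K\<^sup>2 / real CARD('n) + (\<Sum>k=1..i. 1 / norm (v (j k)) ^ 4))" for i
    \<comment> \<open>The bound already holds for \<open>R i\<close>; monotonicity carries it to the
      next residual.\<close>
    unfolding Suc_eq_plus1[symmetric]
    by (rule order_trans[OF nonneg_uga_run_antimono[OF run] nonneg_uga_run_convergence[OF run K_mem]])
qed

end
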